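(* Let $p,q>0$, and let $\mathcal{N}$ be a (finite or infinite) network for the Bass model such that $p_j = p$ and $q_j = q$ for all $j\in\mathcal{M}$, where $q_j=\sum_{k\in\mathcal{M}}q_{k,j}$. Then $$f_m(t;\mathcal{N})\le f_{\rm Bass}(t;p,q),\qquad t\ge 0,\quad m\in\mathcal{M},$$ and so $$f(t;\mathcal{N})\le f_{\rm Bass}(t;p,q),\qquad t\ge 0.$$
   Context: Bass model on a network. Let $\mathcal{M}=\{1,\dots,M\}$ be a set of individuals (nodes), where $M$ may be finite or infinite (if $M=\infty$, $\mathcal{M}=\{1,2,\dots\}$). $X_j(t)\in\{0,1\}$ is the state of $j$ at continuous time $t\ge 0$ ($1$ = adopter, $0$ = nonadopter), with $X_j(0)=0$ for all $j$. Each node $j$ has an external influence rate $p_j>0$, and each ordered pair $(k,j)$ has an internal influence rate $q_{k,j}\ge 0$ of $k$ on $j$, with $q_{k,j}>0$ iff there is a directed edge from $k$ to $j$, and $q_{j,j}=0$; symmetry $q_{k,j}=q_{j,k}$ is not assumed. Adopters remain adopters forever, and a nonadopter $j$ adopts at rate $\lambda_j(t)=p_j+\sum_{k\in\mathcal{M}}q_{k,j}X_k(t)$; i.e. as $\Delta t\to 0$, $\mathbb{P}(X_j(t+\Delta t)=1\mid \mathbf{X}(t))$ equals $1$ if $X_j(t)=1$ and $\big(p_j+\sum_{k\in\mathcal{M}}q_{k,j}X_k(t)\big)\Delta t$ if $X_j(t)=0$, where $\mathbf{X}(t)=(X_1(t),\dots,X_M(t))$. Set $q_j:=\sum_{k\in\mathcal{M}}q_{k,j}$;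 it is assumed that $q_j>0$ for all $j$. The network need not be connected. The network is denoted $\mathcal{N}=\mathcal{N}(\mathcal{M},\{p_k\},\{q_{k,j}\})$. Adoption probability of node $j$: $f_j(t;\mathcal{N}):=\mathbb{P}(X_j(t)=1)$. Expected adoption level: $f(t;\mathcal{N}):=\frac1M\sum_{j=1}^M f_j(t;\mathcal{N})$ if $M<\infty$, and $f(t;\mathcal{N}):=\lim_{M\to\infty}\frac1M\sum_{j=1}^M f_j(t;\mathcal{N})$ for infinite networks. Bass formula: $f_{\rm Bass}(t;p,q)=\dfrac{1-e^{-(p+q)t}}{1+\frac{q}{p}e^{-(p+q)t}}$. *)

theory Defs
  imports "HOL-Probability.Probability"
begin

definition nodes :: "enat \<Rightarrow> nat set" where
  "nodes N = {j. 1 \<le> j \<and> enat j \<le> N}"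

definition total_influence :: "enat \<Rightarrow> (nat \<Rightarrow> nat \<Rightarrow> real) \<Rightarrow> nat \<Rightarrow> real" where
  "total_influence N q j = (\<Sum>\<^sub>\<infinity>k\<in>nodes N. q k j)"

text \<open>
  \<open>q k j\<close> is the influence of \<open>k\<close> on \<open>j\<close>. Summability is stated separately because
  an unsummable \<open>infsum\<close> is \<open>0\<close> by convention. The values of \<open>p\<close> and \<open>q\<close> outside
  \<open>nodes N\<close> are irrelevant.
\<close>

locale bass_network =
  fixes N :: enat and p :: "nat \<Rightarrow> real" and q :: "nat \<Rightarrow> nat \<Rightarrow> real"
  assumes N_pos: "0 < N"
    and p_pos: "\<And>j. j \<in> nodes N \<Longrightarrow> 0 < p j"
    and q_nonneg: "\<And>k j. k \<in> nodes N \<Longrightarrow> j \<in> nodes N \<Longrightarrow> 0 \<le> q k j"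
    and q_self: "\<And>j. j \<in> nodes N \<Longrightarrow> q j j = 0"
    and q_summable: "\<And>j. j \<in> nodes N \<Longrightarrow> (\<lambda>k. q k j) summable_on nodes N"
    and q_total_pos: "\<And>j. j \<in> nodes N \<Longrightarrow> 0 < total_influence N q j"

text \<open>
  A process is given as \<open>X j t \<omega> :: bool\<close>, where \<open>True\<close> is the adopter state \<open>1\<close>.
  \<open>state_algebra\<close> is the sigma-algebra generated by the whole state vector at time \<open>t\<close>.
\<close>

definition state_algebra ::
    "enat \<Rightarrow> 'w measure \<Rightarrow> (nat \<Rightarrow> real \<Rightarrow> 'w \<Rightarrow> bool) \<Rightarrow> real \<Rightarrow> 'w measure" where
  "state_algebra N P X t =
     vimage_algebra (space P) (\<lambda>\<omega>. \<lambda>j\<in>nodes N. X j t \<omega>)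
       (\<Pi>\<^sub>M j\<in>nodes N. count_space UNIV)"

definition cond_prob_state ::
    "enat \<Rightarrow> 'w measure \<Rightarrow> (nat \<Rightarrow> real \<Rightarrow> 'w \<Rightarrow> bool) \<Rightarrow> real \<Rightarrow> ('w \<Rightarrow> bool) \<Rightarrow> 'w \<Rightarrow> real" where
  "cond_prob_state N P X t A =
     real_cond_exp P (state_algebra N P X t) (\<lambda>\<omega>. of_bool (A \<omega>))"

definition adoption_rate ::
    "enat \<Rightarrow> (nat \<Rightarrow> real) \<Rightarrow> (nat \<Rightarrow> nat \<Rightarrow> real) \<Rightarrow> (nat \<Rightarrow> real \<Rightarrow> 'w \<Rightarrow> bool)
      \<Rightarrow> nat \<Rightarrow> real \<Rightarrow> 'w \<Rightarrow> real" where
  "adoption_rate N p q X j t \<omega> = p j + (\<Sum>\<^sub>\<infinity>k\<in>nodes N. q k j * of_bool (X k t \<omega>))"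

text \<open>
  The infinitesimal law is read as follows.

  \<^item> The probability that a nonadopter \<open>j\<close> adopts in \<open>(t, t + h]\<close>, given the state at
    time \<open>t\<close>, is \<open>\<lambda>\<^sub>j(t) h + o(h)\<close>. The \<open>o(h)\<close> is uniform in \<open>t\<close> and in the state.
    If it were merely pointwise in \<open>t\<close>, a process that jumps at a
    deterministic time would satisfy the law.
  \<^item> Distinct nodes adopt as separate transitions: given the state at time \<open>t\<close>, two
    nonadopters both adopt in \<open>(t, t + h]\<close> with probability \<open>o(h)\<close>. The single-node rates
    alone do not exclude simultaneous adoptions.

  When the total influences are finite, both estimates hold uniformly for the
  usual jump process with these rates. The error in the first one is at most
  \<open>h (\<Sum>\<^sub>k q\<^sub>k\<^sub>j (1 - exp (- (p\<^sub>k + q\<^sub>k) h))) + ((p\<^sub>j + q\<^sub>j) h)\<^sup>2\<close>, and the probability in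
  the second one is at most \<open>(p\<^sub>j + q\<^sub>j) (p\<^sub>k + q\<^sub>k) h\<^sup>2\<close>.
\<close>

locale bass_process = bass_network N p q + prob_space P
  for N :: enat and p :: "nat \<Rightarrow> real" and q :: "nat \<Rightarrow> nat \<Rightarrow> real"
    and P :: "'w measure" +
  fixes X :: "nat \<Rightarrow> real \<Rightarrow> 'w \<Rightarrow> bool"
  assumes X_measurable:
      "\<And>j t. j \<in> nodes N \<Longrightarrow> 0 \<le> t \<Longrightarrow> X j t \<in> measurable P (count_space UNIV)"
    and X_initial: "AE \<omega> in P. \<forall>j\<in>nodes N. \<not> X j 0 \<omega>"
    and X_absorbing:
      "AE \<omega> in P. \<forall>j\<in>nodes N. \<forall>s\<ge>0. \<forall>t\<ge>s. X j s \<omega> \<longrightarrow> X j t \<omega>"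
    and X_rate:
      "\<And>j \<epsilon>. j \<in> nodes N \<Longrightarrow> 0 < \<epsilon> \<Longrightarrow>
        \<forall>\<^sub>F h in at_right 0. \<forall>t\<ge>0. AE \<omega> in P. \<not> X j t \<omega> \<longrightarrow>
          \<bar>cond_prob_state N P X t (X j (t + h)) \<omega> - adoption_rate N p q X j t \<omega> * h\<bar> \<le> \<epsilon> * h"
    and X_no_simultaneous:
      "\<And>j k \<epsilon>. j \<in> nodes N \<Longrightarrow> k \<in> nodes N \<Longrightarrow> j \<noteq> k \<Longrightarrow> 0 < \<epsilon> \<Longrightarrow>
        \<forall>\<^sub>F h in at_right 0. \<forall>t\<ge>0. AE \<omega> in P. \<not> X j t \<omega> \<and> \<not> X k t \<omega> \<longrightarrow>
          cond_prob_state N P X t (\<lambda>\<omega>. X j (t + h) \<omega> \<and> X k (t + h) \<omega>) \<omega> \<le> \<epsilon> * h"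

definition adoption_prob ::
    "'w measure \<Rightarrow> (nat \<Rightarrow> real \<Rightarrow> 'w \<Rightarrow> bool) \<Rightarrow> nat \<Rightarrow> real \<Rightarrow> real" where
  "adoption_prob P X j t = \<P>(\<omega> in P. X j t \<omega>)"

definition mean_adoption ::
    "'w measure \<Rightarrow> (nat \<Rightarrow> real \<Rightarrow> 'w \<Rightarrow> bool) \<Rightarrow> nat \<Rightarrow> real \<Rightarrow> real" where
  "mean_adoption P X n t = (1 / real n) * (\<Sum>j=1..n. adoption_prob P X j t)"

text \<open>For \<open>N = \<infinity>\<close> this is meaningful only if the averages converge.\<close>

definition adoption_level ::
    "enat \<Rightarrow> 'w measure \<Rightarrow> (nat \<Rightarrow> real \<Rightarrow> 'w \<Rightarrow> bool) \<Rightarrow> real \<Rightarrow> real" where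
  "adoption_level N P X t =
     (case N of enat n \<Rightarrow> mean_adoption P X n t
      | \<infinity> \<Rightarrow> lim (\<lambda>n. mean_adoption P X n t))"

definition f_Bass :: "real \<Rightarrow> real \<Rightarrow> real \<Rightarrow> real" where
  "f_Bass t p q = (1 - exp (- (p + q) * t)) / (1 + (q / p) * exp (- (p + q) * t))"

end

theory Submission
  imports Defs
begin

text \<open>
  For a finite set \<open>A\<close> of nodes let \<open>S\<^sub>A(t)\<close> (\<open>survival\<close> below) be the probability that no node of
  \<open>A\<close> has adopted by time \<open>t\<close>. The infinitesimal law of the process gives a closed linear system
  for these functions (\<open>survival_increment\<close>, \<open>survival_deriv\<close>):
  \<open>S\<^sub>A' = - \<Sum>\<^sub>j\<^sub>\<in>\<^sub>A ((p\<^sub>j + q\<^sub>j) S\<^sub>A - \<Sum>\<^sub>k q\<^sub>k\<^sub>j S\<^sub>A\<^sub>\<union>\<^sub>k)\<close>,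
  because \<open>S\<^sub>A - S\<^sub>A\<^sub>\<union>\<^sub>k\<close> is the probability that \<open>A\<close> is free of adopters while \<open>k\<close> is already one.

  On the other side, \<open>y = 1 - f_Bass\<close> solves \<open>y' = - (p + q) y + q y\<^sup>2\<close>. Hence \<open>y^n\<close> solves
  \<open>(y^n)' = - n (p + q) y^n + n q y^(n + 1)\<close>, which is the system above for \<open>n = |A|\<close> in a network
  with \<open>p\<^sub>j = p\<close>, \<open>q\<^sub>j = q\<close> if every influence on \<open>A\<close> came from outside \<open>A\<close>. An influence between two
  nodes of \<open>A\<close> has \<open>S\<^sub>A\<^sub>\<union>\<^sub>k = S\<^sub>A\<close>, whereas \<open>y^(n + 1) \<le> y^n\<close>. So \<open>y^|A|\<close> is a subsolution of the
  system for \<open>S\<^sub>A\<close>, with the same initial value 1. The couplings of the system are nonnegative, so a comparison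
  principle applies and yields \<open>y^|A| \<le> S\<^sub>A\<close> for all finite \<open>A\<close>
  (\<open>f_Bass_complement_power_le_survival\<close>). The theorem is the case \<open>A = {m}\<close>, followed by averaging.

  The comparison needs some care, since the system is infinite when the network is, and its
  coefficients grow like \<open>|A|\<close>. The lemma \<open>branching_comparison\<close> deals with this.
\<close>

section \<open>A comparison principle for systems with linearly growing coefficients\<close>

text \<open>
  The index \<open>i\<close> has a size \<open>n i\<close>, and \<open>D i\<close> is driven by indices that are larger by at most one.
  The weight \<open>q n\<close> of the drive is unbounded, so a Gronwall estimate for the supremum of \<open>D\<close>
  over all indices is not available. Instead the a priori bound 1 is fed back into the differential
  inequality \<open>m\<close> times. Each round gains a time integral and a factor that grows with \<open>n\<close>;
  together they stay below \<open>((n + m) choose m) (q (t - t\<^sub>0))^m\<close>. A binomial coefficient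
  is at most \<open>2^(n + m)\<close>, so for \<open>q (t - t\<^sub>0) \<le> 1/4\<close> the bound tends to 0.
\<close>
lemma branching_comparison_step:
  fixes D D' :: "'i \<Rightarrow> real \<Rightarrow> real" and I :: "'i set" and n :: "'i \<Rightarrow> nat"
    and q r t\<^sub>0 T :: real
  assumes "0 \<le> q" "0 \<le> r"
    and short: "4 * q * T \<le> 1"
    and cont: "\<And>i. i \<in> I \<Longrightarrow> continuous_on {t\<^sub>0..t\<^sub>0 + T} (D i)"
    and deriv: "\<And>i t. i \<in> I \<Longrightarrow> t\<^sub>0 < t \<Longrightarrow> t < t\<^sub>0 + T \<Longrightarrow> (D i has_real_derivative D' i t) (at t)"
    and bound: "\<And>i t b. i \<in> I \<Longrightarrow> t\<^sub>0 < t \<Longrightarrow> t < t\<^sub>0 + T \<Longrightarrow> 0 \<le> b \<Longrightarrow>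
        (\<And>i'. i' \<in> I \<Longrightarrow> n i' \<le> Suc (n i) \<Longrightarrow> D i' t \<le> b) \<Longrightarrow>
        D' i t \<le> - r * n i * D i t + q * n i * b"
    and le_1: "\<And>i t. i \<in> I \<Longrightarrow> t\<^sub>0 \<le> t \<Longrightarrow> t \<le> t\<^sub>0 + T \<Longrightarrow> D i t \<le> 1"
    and init: "\<And>i. i \<in> I \<Longrightarrow> D i t\<^sub>0 \<le> 0"
    and "i \<in> I" "t\<^sub>0 \<le> t" "t \<le> t\<^sub>0 + T"
  shows "D i t \<le> 0"
proof -
  define \<phi> where "\<phi> m k s = real ((k + m) choose m) * (q * (s - t\<^sub>0)) ^ m" for m k :: nat and s
  have \<phi>_nonneg: "0 \<le> \<phi> m k s" if "t\<^sub>0 \<le> s" for m k s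
    using that \<open>0 \<le> q\<close> by (simp add: \<phi>_def)
  have claim: "D i s \<le> \<phi> m (n i) s" if "i \<in> I" "t\<^sub>0 \<le> s" "s \<le> t\<^sub>0 + T" for i m s
    using that
  proof (induction m arbitrary: i s)
    case 0
    then show ?case using le_1 by (simp add: \<phi>_def)
  next
    case (Suc m)
    define k where "k = n i"
    define \<phi>' where "\<phi>' s = real ((k + Suc m) choose Suc m) * (real (Suc m) * (q * (q * (s - t\<^sub>0)) ^ m))" for s
    have \<phi>_deriv: "(\<phi> (Suc m) k has_real_derivative \<phi>' s) (at s)" for s
    proof -
      have "((\<lambda>s. q * (s - t\<^sub>0)) has_real_derivative q) (at s)"
        by (auto intro!: derivative_eq_intros)
      from DERIV_cmult[OF DERIV_power_Suc[OF this]] show ?thesis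
        unfolding \<phi>_def \<phi>'_def by (simp only: of_nat_Suc)
    qed
    have \<phi>'_ge: "q * k * \<phi> m (Suc k) s \<le> \<phi>' s" if "t\<^sub>0 \<le> s" for s
    proof -
      have eq: "Suc m * ((k + Suc m) choose Suc m) = Suc k * ((k + Suc m) choose m)"
        using binomial_absorb_comp[of "k + Suc m" m] Suc_times_binomial_eq[of "k+m" m]
        by (metis add_Suc_right add_diff_cancel_right' add_Suc binomial_absorption)
      have "real k * real ((Suc k + m) choose m) \<le> real (Suc m) * real ((k + Suc m) choose Suc m)"
        unfolding of_nat_mult[symmetric] of_nat_le_iff eq by simp
      from mult_right_mono[OF this, of "q * (q * (s - t\<^sub>0)) ^ m"] show ?thesis
        using that \<open>0 \<le> q\<close> by (simp add: \<phi>_def \<phi>'_def mult_ac)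
    qed
    \<comment> \<open>The integrating factor absorbs the damping term; then \<open>F\<close> is nonincreasing.\<close>
    define F where "F s = exp (r * k * s) * (D i s - \<phi> (Suc m) k s)" for s
    have "F s \<le> F t\<^sub>0"
    proof (rule DERIV_nonpos_imp_decreasing_open[where f = F])
      show "t\<^sub>0 \<le> s" by fact
      show "continuous_on {t\<^sub>0..s} F"
        unfolding F_def \<phi>_def using Suc.prems
        by (intro continuous_intros continuous_on_subset[OF cont[OF \<open>i \<in> I\<close>]]) auto
      fix u assume u: "t\<^sub>0 < u" "u < s"
      have D: "(D i has_real_derivative D' i u) (at u)"
        using deriv Suc.prems u by simp
      have "(F has_real_derivative
          (exp (r * k * u) * (r * k * (D i u - \<phi> (Suc m) k u) + (D' i u - \<phi>' u)))) (at u)"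
        unfolding F_def
        by (auto intro!: derivative_eq_intros D \<phi>_deriv simp: algebra_simps)
      moreover have "r * k * (D i u - \<phi> (Suc m) k u) + (D' i u - \<phi>' u) \<le> 0"
      proof -
        have "D' i u \<le> - r * n i * D i u + q * n i * \<phi> m (Suc k) u"
        proof (rule bound)
          fix i' assume i': "i' \<in> I" "n i' \<le> Suc (n i)"
          have "D i' u \<le> \<phi> m (n i') u"
            using Suc.IH i' u Suc.prems by simp
          also have "\<dots> \<le> \<phi> m (Suc k) u"
            unfolding \<phi>_def using u \<open>0 \<le> q\<close> i'
            by (intro mult_right_mono) (auto simp: k_def intro!: binomial_right_mono zero_le_power)
          finally show "D i' u \<le> \<phi> m (Suc k) u" .
        qed (use Suc.prems u \<phi>_nonneg in auto)
        moreover have "0 \<le> r * k * \<phi> (Suc m) k u"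
          using \<phi>_nonneg[of u] u \<open>0 \<le> r\<close> by simp
        ultimately show ?thesis
          using \<phi>'_ge[of u] u by (simp add: k_def algebra_simps)
      qed
      ultimately show "\<exists>y. (F has_real_derivative y) (at u) \<and> y \<le> 0"
        by (metis exp_ge_zero mult_nonneg_nonpos)
    qed
    also have "F t\<^sub>0 \<le> 0"
      using init[OF \<open>i \<in> I\<close>] by (simp add: F_def \<phi>_def mult_nonneg_nonpos)
    finally show ?case
      by (simp add: F_def k_def mult_le_0_iff)
  qed
  have "D i t \<le> 2 ^ n i * (1/2) ^ m" for m
  proof -
    have "D i t \<le> \<phi> m (n i) t" using claim assms by blast
    also have "\<dots> \<le> 2 ^ (n i + m) * (1/4) ^ m"
      unfolding \<phi>_def
    proof (intro mult_mono power_mono)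
      show "real ((n i + m) choose m) \<le> 2 ^ (n i + m)"
        by (metis binomial_le_pow2 of_nat_le_iff of_nat_numeral of_nat_power)
      have "q * (t - t\<^sub>0) \<le> q * T" using assms by (intro mult_left_mono) auto
      then show "q * (t - t\<^sub>0) \<le> 1/4" using short by simp
    qed (use assms in auto)
    also have "\<dots> = 2 ^ n i * (1/2) ^ m"
      by (simp add: power_add field_simps flip: power_mult_distrib)
    finally show ?thesis .
  qed
  moreover have "(\<lambda>m. 2 ^ n i * (1/2) ^ m :: real) \<longlonglongrightarrow> 2 ^ n i * 0"
    by (intro tendsto_intros LIMSEQ_power_zero) simp
  ultimately have "D i t \<le> 2 ^ n i * 0"
    by (intro LIMSEQ_le_const) blast+
  then show ?thesis by simp
qed

text \<open>
  The length of the step depends on \<open>q\<close> only, and at its end \<open>D\<close> is again nonpositive.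
  So steps can be concatenated to reach every time.
\<close>
lemma branching_comparison:
  fixes D D' :: "'i \<Rightarrow> real \<Rightarrow> real" and I :: "'i set" and n :: "'i \<Rightarrow> nat" and q r :: real
  assumes "0 \<le> q" "0 \<le> r"
    and cont: "\<And>i. i \<in> I \<Longrightarrow> continuous_on {0..} (D i)"
    and deriv: "\<And>i t. i \<in> I \<Longrightarrow> 0 < t \<Longrightarrow> (D i has_real_derivative D' i t) (at t)"
    and bound: "\<And>i t b. i \<in> I \<Longrightarrow> 0 < t \<Longrightarrow> 0 \<le> b \<Longrightarrow>
        (\<And>i'. i' \<in> I \<Longrightarrow> n i' \<le> Suc (n i) \<Longrightarrow> D i' t \<le> b) \<Longrightarrow>
        D' i t \<le> - r * n i * D i t + q * n i * b"
    and le_1: "\<And>i t. i \<in> I \<Longrightarrow> 0 \<le> t \<Longrightarrow> D i t \<le> 1"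
    and init: "\<And>i. i \<in> I \<Longrightarrow> D i 0 \<le> 0"
    and "i \<in> I" "0 \<le> t"
  shows "D i t \<le> 0"
proof -
  define T where "T = 1 / (4 * q + 1)"
  have T: "0 < T" "4 * q * T \<le> 1"
    using \<open>0 \<le> q\<close> by (auto simp: T_def field_simps)
  have "D i t \<le> 0" if "i \<in> I" "0 \<le> t" "t \<le> real k * T" for i t k
    using that
  proof (induction k arbitrary: i t)
    case 0
    then show ?case using init by simp
  next
    case (Suc k)
    have kT: "0 \<le> real k * T" using T by simp
    show ?case
    proof (cases "t \<le> real k * T")
      case True
      then show ?thesis using Suc by blast
    next
      case False
      show ?thesis
      proof (rule branching_comparison_step[where D = D and D' = D' and I = I and n = n
            and t\<^sub>0 = "real k * T" and T = T and q = q and r = r])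
        show "D i (real k * T) \<le> 0" if "i \<in> I" for i
          using Suc.IH[OF that kT] by simp
        show "continuous_on {real k * T..real k * T + T} (D i)" if "i \<in> I" for i
          using kT by (intro continuous_on_subset[OF cont[OF that]]) auto
        show "t \<le> real k * T + T"
          using Suc.prems by (simp add: algebra_simps)
        fix i t assume i: "i \<in> I" and t: "real k * T < t"
        have "0 < t" using t kT by simp
        then show "(D i has_real_derivative D' i t) (at t)"
          using deriv i by blast
        show "D' i t \<le> - r * n i * D i t + q * n i * b"
          if "0 \<le> b" "\<And>i'. i' \<in> I \<Longrightarrow> n i' \<le> Suc (n i) \<Longrightarrow> D i' t \<le> b" for b
          using bound i \<open>0 < t\<close> that by blast
      next
        fix i t assume i: "i \<in> I" and t: "real k * T \<le> t"
        show "D i t \<le> 1"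
          using le_1[OF i, of t] t kT by simp
      qed (use assms(1,2) T Suc.prems False in auto)
    qed
  qed
  moreover obtain k :: nat where "t \<le> real k * T"
    using reals_Archimedean3[OF \<open>0 < T\<close>] by (metis less_imp_le)
  ultimately show ?thesis using assms by blast
qed

section \<open>The Bass curve\<close>
lemma f_Bass_complement:
  assumes "0 < p" "0 \<le> q"
  shows "1 - f_Bass t p q = (p + q) * exp (- (p + q) * t) / (p + q * exp (- (p + q) * t))"
proof -
  have "0 < p + q * exp (- (p + q) * t)"
    using assms by (intro add_pos_nonneg) auto
  then show ?thesis
    using assms unfolding f_Bass_def by (simp add: divide_simps) (simp add: algebra_simps)
qed

lemma f_Bass_bounds:
  assumes "0 < p" "0 \<le> q" "0 \<le> t"
  shows "0 \<le> f_Bass t p q" "f_Bass t p q \<le> 1"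
proof -
  show "0 \<le> f_Bass t p q"
    unfolding f_Bass_def using assms
    by (intro divide_nonneg_nonneg add_nonneg_nonneg) (auto simp: mult_nonpos_nonneg)
  have "0 \<le> (p + q) * exp (- (p + q) * t) / (p + q * exp (- (p + q) * t))"
    using assms by (intro divide_nonneg_nonneg add_nonneg_nonneg mult_nonneg_nonneg) auto
  then show "f_Bass t p q \<le> 1"
    using f_Bass_complement[OF assms(1,2), of t] by simp
qed

text \<open>
  The mean-field equation: in the compartmental Bass model a nonadopter fraction \<open>y\<close>
  satisfies \<open>y' = - y (p + q (1 - y))\<close>.
\<close>
lemma f_Bass_complement_deriv:
  assumes "0 < p" "0 \<le> q"
  defines "y \<equiv> \<lambda>t. 1 - f_Bass t p q"
  shows "(y has_real_derivative - (p + q) * y t + q * (y t)\<^sup>2) (at t)"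
proof -
  have y: "y = (\<lambda>t. (p + q) * exp (- (p + q) * t) / (p + q * exp (- (p + q) * t)))"
    unfolding y_def using assms by (intro ext f_Bass_complement)
  have pos: "0 < p + q * exp (- (p + q) * t)"
    using assms by (intro add_pos_nonneg) auto
  define e where "e = exp (- (p + q) * t)"
  have pos': "p + q * e \<noteq> 0" using pos by (simp add: e_def)
  have eq: "((p + q) * (- (p + q) * e) * (p + q * e) - (p + q) * e * (q * (- (p + q) * e)))
       / ((p + q * e) * (p + q * e)) =
      - (p + q) * ((p + q) * e / (p + q * e)) + q * ((p + q) * e / (p + q * e))\<^sup>2"
    using pos' by (simp add: power2_eq_square divide_simps) (simp add: algebra_simps)
  show ?thesis
    unfolding y e_def[symmetric] eq[symmetric]
    using pos' by (auto intro!: derivative_eq_intros simp: e_def mult_ac)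
qed

section \<open>Uniform forward increments determine the derivative\<close>

text \<open>
  Uniformity in \<open>t\<close> turns a forward estimate into a local Lipschitz bound, because an
  increment to the left of \<open>t\<close> is a forward increment from the earlier time.
\<close>
lemma continuous_on_if_uniform_increments:
  fixes f g :: "real \<Rightarrow> real"
  assumes incr: "\<forall>\<^sub>F h in at_right 0. \<forall>t\<ge>0. \<bar>f (t + h) - f t - h * g t\<bar> \<le> h"
    and g: "\<And>t. 0 \<le> t \<Longrightarrow> \<bar>g t\<bar> \<le> K"
  shows "continuous_on {0..} f"
proof -
  obtain d where d: "0 < d"
    "\<And>h t. 0 < h \<Longrightarrow> h < d \<Longrightarrow> 0 \<le> t \<Longrightarrow> \<bar>f (t + h) - f t - h * g t\<bar> \<le> h"
    using incr unfolding eventually_at_right_field by auto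
  have "0 \<le> K" using g[of 0] by simp
  have fwd: "\<bar>f (t + h) - f t\<bar> \<le> (K + 1) * h" if "0 \<le> h" "h < d" "0 \<le> t" for h t
  proof (cases "h = 0")
    case False
    have "\<bar>h * g t\<bar> \<le> K * h"
      using that g[of t] by (simp add: abs_mult mult.commute[of h] mult_right_mono)
    then show ?thesis
      using d(2)[of h t] False that by (simp add: distrib_right)
  qed simp
  have lip: "\<bar>f s - f t\<bar> \<le> (K + 1) * \<bar>s - t\<bar>" if "\<bar>s - t\<bar> < d" "0 \<le> s" "0 \<le> t" for s t
    using fwd[of "s - t" t] fwd[of "t - s" s] that by (cases "t \<le> s") (auto simp: abs_minus_commute)
  show ?thesis
    unfolding continuous_on_iff
  proof (intro ballI allI impI)
    fix t e :: real assume t: "t \<in> {0..}" and "0 < e"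
    show "\<exists>\<delta>>0. \<forall>s\<in>{0..}. dist s t < \<delta> \<longrightarrow> dist (f s) (f t) < e"
    proof (intro exI[of _ "min d (e / (K + 1))"] conjI ballI impI)
      show "0 < min d (e / (K + 1))"
        using d(1) \<open>0 < e\<close> \<open>0 \<le> K\<close> by simp
      fix s assume s: "s \<in> {0..}" "dist s t < min d (e / (K + 1))"
      then have "(K + 1) * \<bar>s - t\<bar> < e"
        using \<open>0 \<le> K\<close> by (simp add: dist_real_def pos_less_divide_eq mult.commute)
      then show "dist (f s) (f t) < e"
        using lip[of s t] s t by (simp add: dist_real_def)
    qed
  qed
qed

text \<open>
  The left difference quotient at \<open>t\<close> is a forward quotient at \<open>t - h\<close>. It is close to \<open>g (t - h)\<close>
  by uniformity, and \<open>g (t - h)\<close> is close to \<open>g t\<close> by continuity.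
\<close>
lemma has_derivative_if_uniform_increments:
  fixes f g :: "real \<Rightarrow> real"
  assumes incr: "\<And>\<epsilon>. 0 < \<epsilon> \<Longrightarrow> \<forall>\<^sub>F h in at_right 0. \<forall>t\<ge>0. \<bar>f (t + h) - f t - h * g t\<bar> \<le> \<epsilon> * h"
    and g: "continuous_on {0..} g" and t: "0 < t"
  shows "(f has_real_derivative g t) (at t)"
  unfolding DERIV_def
proof (rule LIM_I)
  fix e :: real assume "0 < e"
  then have "0 < e / 3" by simp
  from incr[OF this] obtain d where d: "0 < d"
    "\<And>h t. 0 < h \<Longrightarrow> h < d \<Longrightarrow> 0 \<le> t \<Longrightarrow> \<bar>f (t + h) - f t - h * g t\<bar> \<le> e / 3 * h"
    unfolding eventually_at_right_field by auto
  obtain d' where d': "0 < d'" "\<And>s. 0 \<le> s \<Longrightarrow> \<bar>s - t\<bar> < d' \<Longrightarrow> \<bar>g s - g t\<bar> < e / 3"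
    using g t \<open>0 < e / 3\<close> unfolding continuous_on_iff dist_real_def
    by (metis atLeast_iff less_imp_le)
  have quot: "\<bar>(f (s + h) - f s) / h - g s\<bar> \<le> e / 3" if "0 < h" "h < d" "0 \<le> s" for h s
  proof -
    have "(f (s + h) - f s) / h - g s = (f (s + h) - f s - h * g s) / h"
      using that by (simp add: field_simps)
    then show ?thesis
      using d(2)[OF that] that by (simp add: pos_divide_le_eq)
  qed
  show "\<exists>\<delta>>0. \<forall>h. h \<noteq> 0 \<and> norm (h - 0) < \<delta> \<longrightarrow> norm ((f (t + h) - f t) / h - g t) < e"
  proof (intro exI[of _ "min t (min d d')"] conjI allI impI)
    show "0 < min t (min d d')" using t d(1) d'(1) by simp
    fix h :: real assume h: "h \<noteq> 0 \<and> norm (h - 0) < min t (min d d')"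
    show "norm ((f (t + h) - f t) / h - g t) < e"
    proof (cases "0 < h")
      case True
      then show ?thesis using quot[of h t] h t \<open>0 < e\<close> by simp
    next
      case False
      have "(f (t + h) - f t) / h = (f (t + h + - h) - f (t + h)) / - h"
        using h by (simp add: divide_simps)
      moreover have "\<bar>(f (t + h + - h) - f (t + h)) / - h - g (t + h)\<bar> \<le> e / 3"
        by (rule quot) (use h False in auto)
      moreover have "\<bar>g (t + h) - g t\<bar> < e / 3"
        by (rule d'(2)) (use h False in auto)
      ultimately show ?thesis using \<open>0 < e\<close> unfolding real_norm_def by linarith
    qed
  qed
qed

section \<open>Expectations of weighted sums and a Bonferroni inequality\<close>

lemma infsum_on_nat_eq_suminf:
  fixes f :: "nat \<Rightarrow> real" and V :: "nat set"
  assumes "f summable_on V" "\<And>k. k \<in> V \<Longrightarrow> 0 \<le> f k"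
  shows "summable (\<lambda>k. if k \<in> V then f k else 0)"
    and "(\<Sum>\<^sub>\<infinity>k\<in>V. f k) = (\<Sum>k. if k \<in> V then f k else 0)"
proof -
  let ?g = "\<lambda>k. if k \<in> V then f k else 0"
  have "(?g summable_on UNIV) = (f summable_on V)"
    by (rule summable_on_cong_neutral) auto
  then show s: "summable ?g"
    using assms summable_on_UNIV_nonneg_real_iff[of ?g] by auto
  then have "(?g has_sum suminf ?g) UNIV"
    using assms(2) by (intro sums_nonneg_imp_has_sum summable_sums) auto
  moreover have "(\<Sum>\<^sub>\<infinity>k\<in>V. f k) = (\<Sum>\<^sub>\<infinity>k. ?g k)"
    by (rule infsum_cong_neutral) auto
  ultimately show "(\<Sum>\<^sub>\<infinity>k\<in>V. f k) = suminf ?g"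
    by (simp add: infsumI)
qed

text \<open>
  This moves the expectation into the adoption rate, whose sum over influencing nodes is infinite in
  an infinite network.
\<close>
lemma (in prob_space) expectation_infsum:
  fixes c :: "nat \<Rightarrow> real" and V :: "nat set" and Z :: "nat \<Rightarrow> 'a \<Rightarrow> real"
  assumes c: "c summable_on V" "\<And>k. k \<in> V \<Longrightarrow> 0 \<le> c k"
    and Z[measurable]: "\<And>k. k \<in> V \<Longrightarrow> Z k \<in> borel_measurable M"
    and Z01: "\<And>k \<omega>. k \<in> V \<Longrightarrow> 0 \<le> Z k \<omega>" "\<And>k \<omega>. k \<in> V \<Longrightarrow> Z k \<omega> \<le> 1"
  shows "integrable M (\<lambda>\<omega>. \<Sum>\<^sub>\<infinity>k\<in>V. c k * Z k \<omega>)"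
    and "expectation (\<lambda>\<omega>. \<Sum>\<^sub>\<infinity>k\<in>V. c k * Z k \<omega>) = (\<Sum>\<^sub>\<infinity>k\<in>V. c k * expectation (Z k))"
proof -
  let ?f = "\<lambda>k \<omega>. if k \<in> V then c k * Z k \<omega> else 0"
  have summ: "(\<lambda>k. c k * z k) summable_on V" if "\<And>k. k \<in> V \<Longrightarrow> 0 \<le> z k \<and> z k \<le> 1" for z
    using c that by (intro summable_on_comparison_test[OF c(1)]) (auto intro: mult_left_le)
  have eq: "(\<Sum>\<^sub>\<infinity>k\<in>V. c k * Z k \<omega>) = (\<Sum>k. ?f k \<omega>)" for \<omega>
    by (rule infsum_on_nat_eq_suminf(2)) (use summ c Z01 in auto)
  have Zint: "integrable M (Z k)" if "k \<in> V" for k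
    using that Z01 by (intro integrable_const_bound[where B=1]) auto
  have E: "0 \<le> expectation (Z k) \<and> expectation (Z k) \<le> 1" if "k \<in> V" for k
    using that Z01 integral_mono[OF Zint[OF that], of "\<lambda>_. 1"]
    by (auto intro: Bochner_Integration.integral_nonneg simp: prob_space)
  have int: "integrable M (?f k)" for k
    using Zint by (cases "k \<in> V") auto
  have ae: "AE \<omega> in M. summable (\<lambda>k. norm (?f k \<omega>))"
  proof (rule AE_I2)
    fix \<omega>
    have "(\<lambda>k. norm (?f k \<omega>)) = (\<lambda>k. ?f k \<omega>)" using c Z01 by auto
    then show "summable (\<lambda>k. norm (?f k \<omega>))"
      using infsum_on_nat_eq_suminf(1)[of "\<lambda>k. c k * Z k \<omega>" V] summ c Z01 by auto
  qed
  have fE: "(\<integral>\<omega>. ?f k \<omega> \<partial>M) = (if k \<in> V then c k * expectation (Z k) else 0)" for k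
    by auto
  have fE': "(\<lambda>k. \<integral>\<omega>. norm (?f k \<omega>) \<partial>M) = (\<lambda>k. if k \<in> V then c k * expectation (Z k) else 0)"
  proof
    fix k
    have "(\<lambda>\<omega>. norm (?f k \<omega>)) = ?f k" using c Z01 by auto
    then show "(\<integral>\<omega>. norm (?f k \<omega>) \<partial>M) = (if k \<in> V then c k * expectation (Z k) else 0)"
      using fE by simp
  qed
  have sE: "(\<lambda>k. c k * expectation (Z k)) summable_on V"
    using E by (rule summ)
  have sn: "summable (\<lambda>k. \<integral>\<omega>. norm (?f k \<omega>) \<partial>M)"
    unfolding fE' by (rule infsum_on_nat_eq_suminf(1)) (use sE c E in auto)
  show "integrable M (\<lambda>\<omega>. \<Sum>\<^sub>\<infinity>k\<in>V. c k * Z k \<omega>)"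
    unfolding eq by (rule integrable_suminf[OF int ae sn])
  have "expectation (\<lambda>\<omega>. \<Sum>\<^sub>\<infinity>k\<in>V. c k * Z k \<omega>) = (\<Sum>k. if k \<in> V then c k * expectation (Z k) else 0)"
    unfolding eq integral_suminf[OF int ae sn] fE ..
  also have "\<dots> = (\<Sum>\<^sub>\<infinity>k\<in>V. c k * expectation (Z k))"
    by (rule infsum_on_nat_eq_suminf(2)[symmetric]) (use sE c E in auto)
  finally show "expectation (\<lambda>\<omega>. \<Sum>\<^sub>\<infinity>k\<in>V. c k * Z k \<omega>) = (\<Sum>\<^sub>\<infinity>k\<in>V. c k * expectation (Z k))" .
qed

text \<open>
  With \<open>n\<close> the number of \<open>j\<close> such that \<open>B j\<close>, the lower bound says \<open>n - n (n - 1) \<le> 1\<close>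
  for \<open>n \<ge> 1\<close>, which is \<open>0 \<le> (n - 1)\<^sup>2\<close>.
\<close>
lemma bonferroni_of_bool:
  assumes "finite A"
  shows "of_bool (\<exists>j\<in>A. B j) \<le> (\<Sum>j\<in>A. of_bool (B j) :: real)"
    and "(\<Sum>j\<in>A. of_bool (B j)) - (\<Sum>j\<in>A. \<Sum>k\<in>A - {j}. of_bool (B j \<and> B k))
      \<le> (of_bool (\<exists>j\<in>A. B j) :: real)"
proof -
  define n where "n = card {j\<in>A. B j}"
  have 1: "(\<Sum>j\<in>A. of_bool (B j) :: real) = n"
    using assms by (simp add: n_def of_bool_def sum.If_cases Int_def)
  have "(\<Sum>j\<in>A. \<Sum>k\<in>A - {j}. of_bool (B j \<and> B k) :: real) = (\<Sum>j\<in>A. of_bool (B j) * (real n - 1))"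
  proof (rule sum.cong)
    fix j assume "j \<in> A"
    have "(\<Sum>k\<in>A - {j}. of_bool (B j \<and> B k) :: real) = of_bool (B j) * (\<Sum>k\<in>A - {j}. of_bool (B k))"
      by (simp add: sum_distrib_left of_bool_conj)
    also have "(\<Sum>k\<in>A - {j}. of_bool (B k) :: real) = real n - of_bool (B j)"
      using assms \<open>j \<in> A\<close> 1 sum.remove[of A j "\<lambda>k. of_bool (B k) :: real"] by linarith
    finally show "(\<Sum>k\<in>A - {j}. of_bool (B j \<and> B k) :: real) = of_bool (B j) * (real n - 1)"
      by simp
  qed simp
  also have "\<dots> = real n * (real n - 1)"
    by (simp add: 1 flip: sum_distrib_right)
  finally have 2: "(\<Sum>j\<in>A. \<Sum>k\<in>A - {j}. of_bool (B j \<and> B k) :: real) = real n * (real n - 1)" .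
  have n: "(\<exists>j\<in>A. B j) \<longleftrightarrow> 1 \<le> n"
    using assms by (auto simp: n_def card_gt_0_iff Suc_le_eq)
  show "of_bool (\<exists>j\<in>A. B j) \<le> (\<Sum>j\<in>A. of_bool (B j) :: real)"
    unfolding 1 n by auto
  have "0 \<le> (real n - 1)\<^sup>2" by simp
  then show "(\<Sum>j\<in>A. of_bool (B j)) - (\<Sum>j\<in>A. \<Sum>k\<in>A - {j}. of_bool (B j \<and> B k))
      \<le> (of_bool (\<exists>j\<in>A. B j) :: real)"
    unfolding 1 2 n by (cases "n = 0") (auto simp: power2_eq_square algebra_simps)
qed

section \<open>The equations for the survival probabilities\<close>

context bass_process
begin

definition survival :: "nat set \<Rightarrow> real \<Rightarrow> real" where
  "survival A t = \<P>(\<omega> in P. \<forall>j\<in>A. \<not> X j t \<omega>)"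

text \<open>
  The rate of decrease of \<open>survival A\<close>. The inner sum runs over all nodes \<open>k\<close>; for
  \<open>k \<in> A\<close> its term equals \<open>q k j * survival A t\<close> and cancels the corresponding part of
  \<open>total_influence N q j * survival A t\<close>, so only influences from outside \<open>A\<close> contribute.
\<close>
definition survival_loss :: "nat set \<Rightarrow> real \<Rightarrow> real" where
  "survival_loss A t = (\<Sum>j\<in>A. (p j + total_influence N q j) * survival A t
     - (\<Sum>\<^sub>\<infinity>k\<in>nodes N. q k j * survival (insert k A) t))"

lemma pred_X[measurable]: "j \<in> nodes N \<Longrightarrow> 0 \<le> t \<Longrightarrow> Measurable.pred P (X j t)"
  using X_measurable by simp

lemma pred_no_adopter[measurable]:
  "finite A \<Longrightarrow> A \<subseteq> nodes N \<Longrightarrow> 0 \<le> t \<Longrightarrow> Measurable.pred P (\<lambda>\<omega>. \<forall>j\<in>A. \<not> X j t \<omega>)"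
  by (intro pred_intros_finite pred_intros_logic) auto

lemma prob_eq_expectation:
  "Measurable.pred P R \<Longrightarrow> \<P>(\<omega> in P. R \<omega>) = expectation (\<lambda>\<omega>. of_bool (R \<omega>))"
proof -
  assume [measurable]: "Measurable.pred P R"
  have "expectation (\<lambda>\<omega>. of_bool (R \<omega>)) = (expectation (indicator {\<omega>\<in>space P. R \<omega>}) :: real)"
    by (intro Bochner_Integration.integral_cong) (auto simp: indicator_def)
  also have "\<dots> = \<P>(\<omega> in P. R \<omega>)"
    unfolding Bochner_Integration.integral_indicator by (rule arg_cong[where f = prob]) auto
  finally show ?thesis ..
qed

lemma survival_bounds: "0 \<le> survival A t" "survival A t \<le> 1"
  by (auto simp: survival_def)

lemma subalgebra_state: "0 \<le> t \<Longrightarrow> subalgebra P (state_algebra N P X t)"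
  unfolding subalgebra_def state_algebra_def
  by (intro conjI sets_image_in_sets measurable_restrict X_measurable) auto

lemma pred_X_state:
  assumes "j \<in> nodes N"
  shows "Measurable.pred (state_algebra N P X t) (X j t)"
proof -
  let ?f = "\<lambda>\<omega>. \<lambda>j\<in>nodes N. X j t \<omega>"
  have "?f \<in> measurable (state_algebra N P X t) (\<Pi>\<^sub>M j\<in>nodes N. count_space UNIV)"
    unfolding state_algebra_def by (intro measurable_vimage_algebra1) (auto simp: space_PiM)
  from measurable_compose[OF this measurable_component_singleton[OF assms]] show ?thesis
    using assms by simp
qed

text \<open>
  This permits integrating the conditional laws of the process over the event that \<open>A\<close> is free of
  adopters.
\<close>
lemma pred_no_adopter_state:
  "finite A \<Longrightarrow> A \<subseteq> nodes N \<Longrightarrow> Measurable.pred (state_algebra N P X t) (\<lambda>\<omega>. \<forall>j\<in>A. \<not> X j t \<omega>)"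
  by (intro pred_intros_finite pred_intros_logic pred_X_state) auto

lemma expectation_cond_prob_state:
  assumes "0 \<le> t" and R: "Measurable.pred P R" and C: "Measurable.pred (state_algebra N P X t) C"
  shows "integrable P (\<lambda>\<omega>. of_bool (C \<omega>) * cond_prob_state N P X t R \<omega>)"
    and "expectation (\<lambda>\<omega>. of_bool (C \<omega>) * cond_prob_state N P X t R \<omega>) = \<P>(\<omega> in P. C \<omega> \<and> R \<omega>)"
proof -
  note [measurable] = R
  interpret F: finite_measure_subalgebra P "state_algebra N P X t"
    by unfold_locales (rule subalgebra_state[OF assms(1)])
  have [measurable]: "Measurable.pred P C"
    using measurable_from_subalg[OF F.subalg C] .
  have C': "(\<lambda>\<omega>. of_bool (C \<omega>) :: real) \<in> borel_measurable (state_algebra N P X t)"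
    using C by measurable
  have "integrable P (\<lambda>\<omega>. of_bool (C \<omega>) * of_bool (R \<omega>) :: real)"
    by (intro integrable_const_bound[where B=1]) auto
  note * = F.real_cond_exp_intg[OF this C' _]
  show "integrable P (\<lambda>\<omega>. of_bool (C \<omega>) * cond_prob_state N P X t R \<omega>)"
    unfolding cond_prob_state_def by (rule *) measurable
  have "expectation (\<lambda>\<omega>. of_bool (C \<omega>) * cond_prob_state N P X t R \<omega>)
      = expectation (\<lambda>\<omega>. of_bool (C \<omega>) * of_bool (R \<omega>))"
    unfolding cond_prob_state_def by (rule *) measurable
  also have "\<dots> = \<P>(\<omega> in P. C \<omega> \<and> R \<omega>)"
    by (subst prob_eq_expectation) (auto simp: of_bool_conj)
  finally show "expectation (\<lambda>\<omega>. of_bool (C \<omega>) * cond_prob_state N P X t R \<omega>) = \<P>(\<omega> in P. C \<omega> \<and> R \<omega>)" .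
qed

lemma summable_influence_survival:
  assumes "j \<in> nodes N"
  shows "(\<lambda>k. q k j * survival (insert k A) t) summable_on nodes N"
  using q_nonneg assms survival_bounds
  by (intro summable_on_comparison_test[OF q_summable[OF assms]]) (auto intro: mult_left_le)

text \<open>
  The probability that \<open>A\<close> is free of adopters while \<open>k\<close> has adopted is
  \<open>survival A t - survival (insert k A) t\<close>. Weighting with \<open>q k j\<close> and summing over \<open>k\<close>
  gives the expected internal influence on \<open>j\<close>, so the survival probabilities form a closed system.
\<close>
lemma expectation_rate_no_adopter:
  assumes A: "finite A" "A \<subseteq> nodes N" and t: "0 \<le> t" and j: "j \<in> nodes N"
  defines "C \<equiv> \<lambda>\<omega>. \<forall>j\<in>A. \<not> X j t \<omega>"
  shows "integrable P (\<lambda>\<omega>. of_bool (C \<omega>) * adoption_rate N p q X j t \<omega>)"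
    and "expectation (\<lambda>\<omega>. of_bool (C \<omega>) * adoption_rate N p q X j t \<omega>) =
      (p j + total_influence N q j) * survival A t
        - (\<Sum>\<^sub>\<infinity>k\<in>nodes N. q k j * survival (insert k A) t)"
proof -
  have [measurable]: "Measurable.pred P C"
    unfolding C_def using A t by (rule pred_no_adopter)
  let ?Z = "\<lambda>k \<omega>. of_bool (C \<omega> \<and> X k t \<omega>) :: real"
  have eq: "of_bool (C \<omega>) * adoption_rate N p q X j t \<omega> =
      p j * of_bool (C \<omega>) + (\<Sum>\<^sub>\<infinity>k\<in>nodes N. q k j * ?Z k \<omega>)" for \<omega>
    by (simp add: adoption_rate_def of_bool_def)
  have Z: "?Z k \<in> borel_measurable P" if "k \<in> nodes N" for k
    using that t by measurable
  have iC: "integrable P (\<lambda>\<omega>. of_bool (C \<omega>) :: real)"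
    by (intro integrable_const_bound[where B=1]) auto
  have "\<And>k. k \<in> nodes N \<Longrightarrow> 0 \<le> q k j" using q_nonneg j by blast
  note E = expectation_infsum[OF q_summable[OF j] this Z]
  have iZ: "integrable P (\<lambda>\<omega>. \<Sum>\<^sub>\<infinity>k\<in>nodes N. q k j * ?Z k \<omega>)"
    by (rule E) auto
  show "integrable P (\<lambda>\<omega>. of_bool (C \<omega>) * adoption_rate N p q X j t \<omega>)"
    unfolding eq using iC iZ by simp
  have EC: "expectation (\<lambda>\<omega>. of_bool (C \<omega>)) = survival A t"
    using prob_eq_expectation[OF \<open>Measurable.pred P C\<close>] by (simp add: survival_def C_def)
  have EZ: "expectation (?Z k) = survival A t - survival (insert k A) t" if "k \<in> nodes N" for k
  proof -
    have [measurable]: "Measurable.pred P (X k t)"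
      using that t by (rule pred_X)
    have "(\<forall>j\<in>insert k A. \<not> X j t \<omega>) \<longleftrightarrow> C \<omega> \<and> \<not> X k t \<omega>" for \<omega>
      by (auto simp: C_def)
    then have "survival (insert k A) t = expectation (\<lambda>\<omega>. of_bool (C \<omega> \<and> \<not> X k t \<omega>))"
      unfolding survival_def by (simp only:) (intro prob_eq_expectation, measurable)
    moreover have "expectation (?Z k) + expectation (\<lambda>\<omega>. of_bool (C \<omega> \<and> \<not> X k t \<omega>))
        = expectation (\<lambda>\<omega>. ?Z k \<omega> + of_bool (C \<omega> \<and> \<not> X k t \<omega>))"
      using that t Z
      by (intro Bochner_Integration.integral_add[symmetric] integrable_const_bound[where B=1]) auto
    moreover have "\<dots> = expectation (\<lambda>\<omega>. of_bool (C \<omega>))"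
      by (intro Bochner_Integration.integral_cong) auto
    ultimately show ?thesis using EC by simp
  qed
  have "expectation (\<lambda>\<omega>. \<Sum>\<^sub>\<infinity>k\<in>nodes N. q k j * ?Z k \<omega>) = (\<Sum>\<^sub>\<infinity>k\<in>nodes N. q k j * expectation (?Z k))"
    by (rule E) auto
  also have "\<dots> = (\<Sum>\<^sub>\<infinity>k\<in>nodes N. q k j * survival A t - q k j * survival (insert k A) t)"
    by (intro infsum_cong) (simp add: EZ algebra_simps)
  also have "\<dots> = (\<Sum>\<^sub>\<infinity>k\<in>nodes N. q k j * survival A t) - (\<Sum>\<^sub>\<infinity>k\<in>nodes N. q k j * survival (insert k A) t)"
    using infsum_add[OF summable_on_cmult_left[OF q_summable[OF j]]
        summable_on_uminus[THEN iffD2, OF summable_influence_survival[OF j]], of "survival A t" A t]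
    by (simp add: infsum_uminus)
  also have "(\<Sum>\<^sub>\<infinity>k\<in>nodes N. q k j * survival A t) = total_influence N q j * survival A t"
    unfolding total_influence_def by (rule infsum_cmult_left) (use q_summable j in blast)
  finally show "expectation (\<lambda>\<omega>. of_bool (C \<omega>) * adoption_rate N p q X j t \<omega>) =
      (p j + total_influence N q j) * survival A t
        - (\<Sum>\<^sub>\<infinity>k\<in>nodes N. q k j * survival (insert k A) t)"
    unfolding eq using iC iZ EC by (simp add: algebra_simps)
qed

text \<open>
  Since adopters stay adopters, the loss of survival in \<open>(t, t + h]\<close> is the probability that \<open>A\<close> is
  free at time \<open>t\<close> and some \<open>j \<in> A\<close> adopts by \<open>t + h\<close>. By inclusion and exclusion it is
  the sum of the probabilities for single \<open>j\<close>, which the rates determine up to \<open>o(h)\<close>, up to the sum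
  of those for pairs, which is \<open>o(h)\<close> because adoptions are not simultaneous. All errors are uniform
  in \<open>t\<close>.
\<close>
lemma survival_increment:
  assumes A: "finite A" "A \<subseteq> nodes N" and "0 < \<epsilon>"
  shows "\<forall>\<^sub>F h in at_right 0. \<forall>t\<ge>0.
    \<bar>survival A (t + h) - survival A t + h * survival_loss A t\<bar> \<le> \<epsilon> * h"
proof -
  define n where "n = real (card A)"
  \<comment> \<open>There are at most \<open>n\<close> single and \<open>n\<^sup>2\<close> pair errors, each at most \<open>\<eta> h\<close>; the summand 1
    keeps the denominator positive for empty \<open>A\<close>.\<close>
  define \<eta> where "\<eta> = \<epsilon> / (n + n * n + 1)"
  have n: "0 \<le> n" by (simp add: n_def)
  have \<eta>: "0 < \<eta>"
    using \<open>0 < \<epsilon>\<close> n by (auto simp: \<eta>_def intro!: divide_pos_pos add_nonneg_pos)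
  have \<eta>n: "(n + n * n) * \<eta> \<le> \<epsilon>"
  proof -
    have "0 < n + n * n + 1" using n by (simp add: add_nonneg_pos)
    then have "(n + n * n) * \<eta> = \<epsilon> - \<eta>"
      unfolding \<eta>_def by (simp add: field_simps)
    then show ?thesis using \<eta> by simp
  qed
  have single: "\<forall>\<^sub>F h in at_right 0. \<forall>j\<in>A. \<forall>t\<ge>0. AE \<omega> in P. \<not> X j t \<omega> \<longrightarrow>
      \<bar>cond_prob_state N P X t (X j (t + h)) \<omega> - adoption_rate N p q X j t \<omega> * h\<bar> \<le> \<eta> * h"
    using A X_rate[OF _ \<eta>] by (intro eventually_ball_finite) auto
  have double: "\<forall>\<^sub>F h in at_right 0. \<forall>j\<in>A. \<forall>k\<in>A - {j}. \<forall>t\<ge>0. AE \<omega> in P.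
      \<not> X j t \<omega> \<and> \<not> X k t \<omega> \<longrightarrow>
      cond_prob_state N P X t (\<lambda>\<omega>. X j (t + h) \<omega> \<and> X k (t + h) \<omega>) \<omega> \<le> \<eta> * h"
    using A X_no_simultaneous[OF _ _ _ \<eta>] by (intro eventually_ball_finite ballI) auto
  have "\<forall>\<^sub>F h in at_right (0::real). 0 < h"
    by (simp add: eventually_at_right_less)
  with single double show ?thesis
  proof eventually_elim
    case (elim h)
    show ?case
    proof (intro allI impI)
      fix t :: real assume t: "0 \<le> t"
      then have th: "0 \<le> t + h" using \<open>0 < h\<close> by simp
      define C where "C \<omega> \<longleftrightarrow> (\<forall>j\<in>A. \<not> X j t \<omega>)" for \<omega>
      have [measurable]: "Measurable.pred P C"
        unfolding C_def using A t by (rule pred_no_adopter)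
      have CF: "Measurable.pred (state_algebra N P X t) C"
        unfolding C_def using A by (rule pred_no_adopter_state)
      have [measurable]: "Measurable.pred P (X j (t + h))" if "j \<in> A" for j
        using that A th by auto
      have int: "integrable P (\<lambda>\<omega>. of_bool (R \<omega>) :: real)" if [measurable]: "Measurable.pred P R" for R
        by (intro integrable_const_bound[where B=1]) auto
      let ?a = "\<lambda>j. \<P>(\<omega> in P. C \<omega> \<and> X j (t + h) \<omega>)"
      let ?b = "\<lambda>j k. \<P>(\<omega> in P. C \<omega> \<and> (X j (t + h) \<omega> \<and> X k (t + h) \<omega>))"
      let ?R = "\<lambda>j \<omega>. of_bool (C \<omega>) * adoption_rate N p q X j t \<omega>"
      have a: "\<bar>?a j - h * expectation (?R j)\<bar> \<le> \<eta> * h" if j: "j \<in> A" for j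
      proof -
        have jN: "j \<in> nodes N" using j A by blast
        let ?K = "\<lambda>\<omega>. of_bool (C \<omega>) * cond_prob_state N P X t (X j (t + h)) \<omega>"
        have Xj: "Measurable.pred P (X j (t + h))" using jN th by (rule pred_X)
        note K = expectation_cond_prob_state[OF t Xj CF]
        have iR: "integrable P (\<lambda>\<omega>. h * ?R j \<omega>)"
          using expectation_rate_no_adopter(1)[OF A t jN]
          unfolding C_def by (rule integrable_mult_right)
        have "?a j - h * expectation (?R j) = expectation ?K - expectation (\<lambda>\<omega>. h * ?R j \<omega>)"
          by (simp only: K(2) integral_mult_right_zero)
        also have "\<dots> = expectation (\<lambda>\<omega>. ?K \<omega> - h * ?R j \<omega>)"
          using K(1) iR by (rule Bochner_Integration.integral_diff[symmetric])
        finally have "\<bar>?a j - h * expectation (?R j)\<bar> = \<bar>expectation (\<lambda>\<omega>. ?K \<omega> - h * ?R j \<omega>)\<bar>"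
          by (rule arg_cong)
        also have "\<dots> \<le> expectation (\<lambda>\<omega>. \<bar>?K \<omega> - h * ?R j \<omega>\<bar>)"
          by (rule integral_abs_bound)
        also have "\<dots> \<le> expectation (\<lambda>\<omega>. \<eta> * h)"
        proof (rule integral_mono_AE)
          show "AE \<omega> in P. \<bar>?K \<omega> - h * ?R j \<omega>\<bar> \<le> \<eta> * h"
            using bspec[OF elim(1) j, rule_format, OF t]
          proof eventually_elim
            case (elim \<omega>)
            then show ?case
              using j \<eta> \<open>0 < h\<close> by (cases "C \<omega>") (auto simp: C_def mult.commute)
          qed
          show "integrable P (\<lambda>\<omega>. \<bar>?K \<omega> - h * ?R j \<omega>\<bar>)"
            using K(1) iR by (intro integrable_abs Bochner_Integration.integrable_diff)
        qed simp
        finally show ?thesis by (simp add: prob_space)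
      qed
      have b: "?b j k \<le> \<eta> * h" if j: "j \<in> A" and k: "k \<in> A - {j}" for j k
      proof -
        let ?K = "\<lambda>\<omega>. of_bool (C \<omega>) * cond_prob_state N P X t (\<lambda>\<omega>. X j (t + h) \<omega> \<and> X k (t + h) \<omega>) \<omega>"
        have Xjk: "Measurable.pred P (\<lambda>\<omega>. X j (t + h) \<omega> \<and> X k (t + h) \<omega>)"
          using j k by (intro pred_intros_logic) auto
        note K = expectation_cond_prob_state[OF t Xjk CF]
        have "expectation ?K \<le> expectation (\<lambda>\<omega>. \<eta> * h)"
        proof (rule integral_mono_AE)
          show "AE \<omega> in P. ?K \<omega> \<le> \<eta> * h"
            using bspec[OF bspec[OF elim(2) j] k, rule_format, OF t]
          proof eventually_elim
            case (elim \<omega>)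
            then show ?case
              using j k \<eta> \<open>0 < h\<close> by (cases "C \<omega>") (auto simp: C_def)
          qed
        qed (rule K(1), simp)
        then show ?thesis
          unfolding K(2) by (simp add: prob_space)
      qed
      let ?any = "\<lambda>\<omega>. \<exists>j\<in>A. C \<omega> \<and> X j (t + h) \<omega>"
      have [measurable]: "Measurable.pred P ?any"
        using A by (intro pred_intros_finite) auto
      \<comment> \<open>If \<open>A\<close> is free at \<open>t + h\<close>, it was already free at \<open>t\<close>.\<close>
      have drop: "survival A t - survival A (t + h) = \<P>(\<omega> in P. ?any \<omega>)"
      proof -
        have m: "Measurable.pred P (\<lambda>\<omega>. \<forall>j\<in>A. \<not> X j (t + h) \<omega>)"
          using A th by (rule pred_no_adopter)
        have "survival A t = expectation (\<lambda>\<omega>. of_bool (C \<omega>))"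
          unfolding survival_def C_def[symmetric] by (simp add: prob_eq_expectation)
        also have "\<dots> = expectation (\<lambda>\<omega>. of_bool (\<forall>j\<in>A. \<not> X j (t + h) \<omega>) + of_bool (?any \<omega>))"
        proof (rule integral_cong_AE)
          show "AE \<omega> in P. (of_bool (C \<omega>) :: real)
              = of_bool (\<forall>j\<in>A. \<not> X j (t + h) \<omega>) + of_bool (?any \<omega>)"
            using X_absorbing
          proof eventually_elim
            fix \<omega> assume *: "\<forall>j\<in>nodes N. \<forall>s\<ge>0. \<forall>t\<ge>s. X j s \<omega> \<longrightarrow> X j t \<omega>"
            have "X j (t + h) \<omega>" if "j \<in> A" "X j t \<omega>" for j
              using *[rule_format, of j t "t + h"] that A t \<open>0 < h\<close> by auto
            then show "(of_bool (C \<omega>) :: real)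
              = of_bool (\<forall>j\<in>A. \<not> X j (t + h) \<omega>) + of_bool (?any \<omega>)"
              by (auto simp: C_def)
          qed
        qed (use m in measurable)
        also have "\<dots> = survival A (t + h) + \<P>(\<omega> in P. ?any \<omega>)"
          using m by (simp add: int survival_def prob_eq_expectation)
        finally show ?thesis by simp
      qed
      have sum_a: "(\<Sum>j\<in>A. ?a j) = expectation (\<lambda>\<omega>. \<Sum>j\<in>A. of_bool (C \<omega> \<and> X j (t + h) \<omega>))"
        by (subst Bochner_Integration.integral_sum) (auto intro!: sum.cong int prob_eq_expectation)
      define B where "B j k \<omega> = (of_bool ((C \<omega> \<and> X j (t + h) \<omega>) \<and> (C \<omega> \<and> X k (t + h) \<omega>)) :: real)" for j k \<omega>
      have iB: "integrable P (B j k)" if "j \<in> A" "k \<in> A" for j k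
        unfolding B_def using that by (intro int) auto
      have sum_b: "(\<Sum>j\<in>A. \<Sum>k\<in>A - {j}. ?b j k) = expectation (\<lambda>\<omega>. \<Sum>j\<in>A. \<Sum>k\<in>A - {j}. B j k \<omega>)"
      proof -
        have "?b j k = expectation (B j k)" if "j \<in> A" "k \<in> A" for j k
        proof -
          have "B j k = (\<lambda>\<omega>. of_bool (C \<omega> \<and> (X j (t + h) \<omega> \<and> X k (t + h) \<omega>)))"
            by (auto simp: B_def)
          then show ?thesis
            using that by (simp only:) (intro prob_eq_expectation, measurable)
        qed
        then have "(\<Sum>j\<in>A. \<Sum>k\<in>A - {j}. ?b j k) = (\<Sum>j\<in>A. \<Sum>k\<in>A - {j}. expectation (B j k))"
          by (intro sum.cong) auto
        also have "\<dots> = (\<Sum>j\<in>A. expectation (\<lambda>\<omega>. \<Sum>k\<in>A - {j}. B j k \<omega>))"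
          by (intro sum.cong refl Bochner_Integration.integral_sum[symmetric] iB) auto
        also have "\<dots> = expectation (\<lambda>\<omega>. \<Sum>j\<in>A. \<Sum>k\<in>A - {j}. B j k \<omega>)"
          by (intro Bochner_Integration.integral_sum[symmetric] Bochner_Integration.integrable_sum iB) auto
        finally show ?thesis .
      qed
      have upper: "survival A t - survival A (t + h) \<le> (\<Sum>j\<in>A. ?a j)"
      proof -
        have "\<P>(\<omega> in P. ?any \<omega>) = expectation (\<lambda>\<omega>. of_bool (?any \<omega>))"
          by (rule prob_eq_expectation) measurable
        also have "\<dots> \<le> expectation (\<lambda>\<omega>. \<Sum>j\<in>A. of_bool (C \<omega> \<and> X j (t + h) \<omega>))"
          by (intro integral_mono int Bochner_Integration.integrable_sum bonferroni_of_bool(1)[OF A(1)]) auto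
        finally show ?thesis unfolding drop sum_a .
      qed
      have lower: "(\<Sum>j\<in>A. ?a j) - (\<Sum>j\<in>A. \<Sum>k\<in>A - {j}. ?b j k) \<le> survival A t - survival A (t + h)"
      proof -
        let ?f = "\<lambda>\<omega>. \<Sum>j\<in>A. of_bool (C \<omega> \<and> X j (t + h) \<omega>) :: real"
        let ?g = "\<lambda>\<omega>. \<Sum>j\<in>A. \<Sum>k\<in>A - {j}. B j k \<omega>"
        have if': "integrable P ?f"
          by (intro Bochner_Integration.integrable_sum int) auto
        have ig: "integrable P ?g"
          by (intro Bochner_Integration.integrable_sum iB) auto
        have "expectation ?f - expectation ?g = expectation (\<lambda>\<omega>. ?f \<omega> - ?g \<omega>)"
          by (rule Bochner_Integration.integral_diff[symmetric]) fact+
        also have "\<dots> \<le> expectation (\<lambda>\<omega>. of_bool (?any \<omega>))"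
        proof (rule integral_mono)
          show "?f \<omega> - ?g \<omega> \<le> of_bool (?any \<omega>)" for \<omega>
            unfolding B_def by (rule bonferroni_of_bool(2)[OF A(1)])
          show "integrable P (\<lambda>\<omega>. ?f \<omega> - ?g \<omega>)"
            using if' ig by (rule Bochner_Integration.integrable_diff)
          show "integrable P (\<lambda>\<omega>. of_bool (?any \<omega>) :: real)"
            by (rule int) measurable
        qed
        also have "\<dots> = \<P>(\<omega> in P. ?any \<omega>)"
          by (rule prob_eq_expectation[symmetric]) measurable
        finally show ?thesis unfolding drop sum_a sum_b .
      qed
      have loss: "survival_loss A t = (\<Sum>j\<in>A. expectation (?R j))"
        unfolding survival_loss_def C_def
        using A by (intro sum.cong refl expectation_rate_no_adopter(2)[OF A t, symmetric]) auto
      have "\<bar>(\<Sum>j\<in>A. ?a j) - h * survival_loss A t\<bar> = \<bar>\<Sum>j\<in>A. ?a j - h * expectation (?R j)\<bar>"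
        by (simp add: loss sum_subtractf sum_distrib_left)
      also have "\<dots> \<le> (\<Sum>j\<in>A. \<eta> * h)"
        by (rule order_trans[OF sum_abs sum_mono]) (rule a)
      finally have 1: "\<bar>(\<Sum>j\<in>A. ?a j) - h * survival_loss A t\<bar> \<le> n * (\<eta> * h)"
        by (simp add: n_def)
      have "(\<Sum>j\<in>A. \<Sum>k\<in>A - {j}. ?b j k) \<le> (\<Sum>j\<in>A. \<Sum>k\<in>A - {j}. \<eta> * h)"
        by (intro sum_mono b)
      also have "\<dots> \<le> (\<Sum>j\<in>A. \<Sum>k\<in>A. \<eta> * h)"
        using A \<eta> \<open>0 < h\<close> by (intro sum_mono sum_mono2) auto
      finally have 2: "(\<Sum>j\<in>A. \<Sum>k\<in>A - {j}. ?b j k) \<le> n * n * (\<eta> * h)"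
        by (simp add: n_def mult.assoc)
      have "(n + n * n) * \<eta> * h \<le> \<epsilon> * h"
        using \<eta>n \<open>0 < h\<close> by (intro mult_right_mono) auto
      moreover have "0 \<le> n * n * (\<eta> * h)" "0 \<le> n * (\<eta> * h)"
        using n \<eta> \<open>0 < h\<close> by auto
      ultimately show "\<bar>survival A (t + h) - survival A t + h * survival_loss A t\<bar> \<le> \<epsilon> * h"
        using 1 2 upper lower unfolding abs_le_iff by (simp add: algebra_simps)
    qed
  qed
qed

lemma infsum_influence_survival_bounds:
  assumes "j \<in> nodes N"
  shows "0 \<le> (\<Sum>\<^sub>\<infinity>k\<in>nodes N. q k j * survival (insert k A) t)"
    and "(\<Sum>\<^sub>\<infinity>k\<in>nodes N. q k j * survival (insert k A) t) \<le> total_influence N q j"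
proof -
  show "0 \<le> (\<Sum>\<^sub>\<infinity>k\<in>nodes N. q k j * survival (insert k A) t)"
    using assms q_nonneg survival_bounds by (intro infsum_nonneg) auto
  show "(\<Sum>\<^sub>\<infinity>k\<in>nodes N. q k j * survival (insert k A) t) \<le> total_influence N q j"
    unfolding total_influence_def using assms q_nonneg survival_bounds
    by (intro infsum_mono summable_influence_survival q_summable) (auto intro: mult_left_le)
qed

text \<open>
  A bound that is uniform in time makes \<open>survival A\<close> continuous.
\<close>
lemma survival_loss_bound:
  assumes "A \<subseteq> nodes N"
  shows "\<bar>survival_loss A t\<bar> \<le> (\<Sum>j\<in>A. p j + total_influence N q j)"
  unfolding survival_loss_def
proof (intro order_trans[OF sum_abs sum_mono])
  fix j assume "j \<in> A"
  then have j: "j \<in> nodes N" using assms by blast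
  have "0 \<le> p j + total_influence N q j"
    using p_pos[OF j] q_total_pos[OF j] by simp
  then have "0 \<le> (p j + total_influence N q j) * survival A t"
    "(p j + total_influence N q j) * survival A t \<le> p j + total_influence N q j"
    using survival_bounds by (auto intro: mult_left_le)
  then show "\<bar>(p j + total_influence N q j) * survival A t
      - (\<Sum>\<^sub>\<infinity>k\<in>nodes N. q k j * survival (insert k A) t)\<bar> \<le> p j + total_influence N q j"
    using infsum_influence_survival_bounds[OF j, of A t] p_pos[OF j] by linarith
qed

lemma continuous_on_survival:
  assumes "finite A" "A \<subseteq> nodes N"
  shows "continuous_on {0..} (survival A)"
proof (rule continuous_on_if_uniform_increments)
  show "\<forall>\<^sub>F h in at_right 0. \<forall>t\<ge>0. \<bar>survival A (t + h) - survival A t - h * (- survival_loss A t)\<bar> \<le> h"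
    using survival_increment[OF assms zero_less_one] by simp
  show "\<bar>- survival_loss A t\<bar> \<le> (\<Sum>j\<in>A. p j + total_influence N q j)" for t
    using survival_loss_bound[OF assms(2)] by simp
qed

text \<open>
  The series over influencing nodes is dominated by the summable weights \<open>q k j\<close>, uniformly in time,
  so continuity passes to its sum.
\<close>
lemma continuous_on_survival_loss:
  assumes "finite A" "A \<subseteq> nodes N"
  shows "continuous_on {0..} (survival_loss A)"
proof -
  have "continuous_on {0..} (\<lambda>t. \<Sum>\<^sub>\<infinity>k\<in>nodes N. q k j * survival (insert k A) t)" if "j \<in> A" for j
  proof (rule uniform_limit_theorem)
    have j: "j \<in> nodes N" using that assms by blast
    show "uniform_limit {0..} (\<lambda>V t. \<Sum>k\<in>V. q k j * survival (insert k A) t)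
        (\<lambda>t. \<Sum>\<^sub>\<infinity>k\<in>nodes N. q k j * survival (insert k A) t) (finite_subsets_at_top (nodes N))"
      using j q_nonneg survival_bounds
      by (intro Weierstrass_m_test_general[where M = "\<lambda>k. q k j"] q_summable)
         (auto simp: abs_mult intro: mult_left_le)
    show "\<forall>\<^sub>F V in finite_subsets_at_top (nodes N).
        continuous_on {0..} (\<lambda>t. \<Sum>k\<in>V. q k j * survival (insert k A) t)"
      using assms by (intro eventually_finite_subsets_at_top_weakI continuous_intros continuous_on_survival) auto
  qed simp
  then show ?thesis
    unfolding survival_loss_def using assms
    by (intro continuous_intros continuous_on_survival) auto
qed

lemma survival_deriv:
  assumes "finite A" "A \<subseteq> nodes N" "0 < t"
  shows "(survival A has_real_derivative - survival_loss A t) (at t)"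
proof (rule has_derivative_if_uniform_increments)
  show "\<forall>\<^sub>F h in at_right 0. \<forall>t\<ge>0. \<bar>survival A (t + h) - survival A t - h * (- survival_loss A t)\<bar> \<le> \<epsilon> * h"
    if "0 < \<epsilon>" for \<epsilon>
    using survival_increment[OF assms(1,2) that] by simp
  show "continuous_on {0..} (\<lambda>t. - survival_loss A t)"
    using assms by (intro continuous_intros continuous_on_survival_loss)
qed fact

lemma survival_0:
  assumes "finite A" "A \<subseteq> nodes N"
  shows "survival A 0 = 1"
  unfolding survival_def
proof (subst prob_Collect_eq_1)
  show "{\<omega> \<in> space P. \<forall>j\<in>A. \<not> X j 0 \<omega>} \<in> events"
    using pred_no_adopter[OF assms, of 0] by simp
  show "AE \<omega> in P. \<forall>j\<in>A. \<not> X j 0 \<omega>"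
    using X_initial assms by (auto elim!: eventually_mono)
qed

end

section \<open>Comparison with the Bass curve\<close>

context bass_process
begin

text \<open>
  The deficit \<open>D A = y^|A| - S\<^sub>A\<close> has initial value 0 and is at most 1. Subtracting the equations for \<open>y^|A|\<close>
  and \<open>S\<^sub>A\<close> shows that it is damped at rate \<open>|A| (p + q)\<close> and driven by the deficits
  \<open>y^(|A| + 1) - S\<^sub>A\<^sub>\<union>\<^sub>k\<close> with total weight \<open>|A| q\<close>. These are at most \<open>D (A \<union> {k})\<close>, with equality
  when \<open>k \<notin> A\<close>, so the comparison principle applies with the cardinality as size.
\<close>
lemma f_Bass_complement_power_le_survival:
  assumes p: "\<And>j. j \<in> nodes N \<Longrightarrow> p j = p\<^sub>0" "0 < p\<^sub>0"
    and q: "\<And>j. j \<in> nodes N \<Longrightarrow> total_influence N q j = q\<^sub>0" "0 \<le> q\<^sub>0"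
    and "finite A" "A \<subseteq> nodes N" "0 \<le> t"
  shows "(1 - f_Bass t p\<^sub>0 q\<^sub>0) ^ card A \<le> survival A t"
proof -
  define y where "y t = 1 - f_Bass t p\<^sub>0 q\<^sub>0" for t
  define I where "I = {A. finite A \<and> A \<subseteq> nodes N}"
  define D where "D A t = y t ^ card A - survival A t" for A t
  define D' where "D' A t = card A * (- (p\<^sub>0 + q\<^sub>0) * y t ^ card A + q\<^sub>0 * y t ^ Suc (card A))
      + survival_loss A t" for A t
  have y01: "0 \<le> y t" "y t \<le> 1" if "0 \<le> t" for t
    using f_Bass_bounds[OF p(2) q(2) that] by (auto simp: y_def)
  have y_deriv: "(y has_real_derivative - (p\<^sub>0 + q\<^sub>0) * y t + q\<^sub>0 * (y t)\<^sup>2) (at t)" for t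
    unfolding y_def using f_Bass_complement_deriv[OF p(2) q(2)] .
  have yn_deriv: "((\<lambda>t. y t ^ n) has_real_derivative
      n * (- (p\<^sub>0 + q\<^sub>0) * y t ^ n + q\<^sub>0 * y t ^ Suc n)) (at t)" for n t
  proof (cases n)
    case (Suc m)
    show ?thesis
      using DERIV_power_Suc[OF y_deriv[of t], of m] unfolding Suc
      by (simp add: algebra_simps power2_eq_square)
  qed simp
  have loss: "survival_loss A t = card A * ((p\<^sub>0 + q\<^sub>0) * survival A t)
      - (\<Sum>j\<in>A. \<Sum>\<^sub>\<infinity>k\<in>nodes N. q k j * survival (insert k A) t)" if "A \<subseteq> nodes N" for A t
  proof -
    have "survival_loss A t = (\<Sum>j\<in>A. (p\<^sub>0 + q\<^sub>0) * survival A t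
        - (\<Sum>\<^sub>\<infinity>k\<in>nodes N. q k j * survival (insert k A) t))"
      unfolding survival_loss_def using p(1) q(1) that by (intro sum.cong) auto
    then show ?thesis by (simp add: sum_subtractf)
  qed
  have "D A t \<le> 0"
  proof (rule branching_comparison[where D = D and D' = D' and I = I and n = card
        and q = q\<^sub>0 and r = "p\<^sub>0 + q\<^sub>0"])
    show "0 \<le> q\<^sub>0" "0 \<le> p\<^sub>0 + q\<^sub>0" using p(2) q(2) by auto
    show "A \<in> I" "0 \<le> t" using assms by (auto simp: I_def)
    fix A assume "A \<in> I"
    then have A: "finite A" "A \<subseteq> nodes N" by (auto simp: I_def)
    have "continuous_on {0..} y"
      using DERIV_isCont[OF y_deriv] by (intro continuous_at_imp_continuous_on) blast
    then show "continuous_on {0..} (D A)"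
      unfolding D_def using continuous_on_survival[OF A] by (intro continuous_intros)
    have "y 0 = 1" by (simp add: y_def f_Bass_def)
    then show "D A 0 \<le> 0"
      by (simp add: D_def survival_0[OF A])
    show "D A t \<le> 1" if "0 \<le> t" for t
      unfolding D_def using power_le_one[OF y01[OF that], of "card A"] survival_bounds[of A t] by linarith
    fix t :: real assume t: "0 < t"
    show "(D A has_real_derivative D' A t) (at t)"
      using DERIV_diff[OF yn_deriv[of "card A" t] survival_deriv[OF A t]]
      unfolding D_def D'_def by simp
    fix b :: real assume "0 \<le> b"
      and b: "\<And>B. B \<in> I \<Longrightarrow> card B \<le> Suc (card A) \<Longrightarrow> D B t \<le> b"
    \<comment> \<open>Here the inequality \<open>y^(|A| + 1) \<le> y^|A|\<close> covers the influences within \<open>A\<close>.\<close>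
    have lower: "y t ^ Suc (card A) - b \<le> survival (insert k A) t" if "k \<in> nodes N" for k
    proof -
      have card: "card (insert k A) \<le> Suc (card A)" by (simp add: card_insert_le_m1 A card_insert_if)
      then have "y t ^ Suc (card A) \<le> y t ^ card (insert k A)"
        using y01[of t] t by (intro power_decreasing) auto
      also have "\<dots> \<le> survival (insert k A) t + b"
        using b[of "insert k A"] card A that by (auto simp: D_def I_def)
      finally show ?thesis by simp
    qed
    have "q\<^sub>0 * (y t ^ Suc (card A) - b) \<le> (\<Sum>\<^sub>\<infinity>k\<in>nodes N. q k j * survival (insert k A) t)" if "j \<in> A" for j
    proof -
      have j: "j \<in> nodes N" using that A by blast
      have "q\<^sub>0 * (y t ^ Suc (card A) - b) = (\<Sum>\<^sub>\<infinity>k\<in>nodes N. q k j * (y t ^ Suc (card A) - b))"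
        using q(1)[OF j] q_summable[OF j] by (subst infsum_cmult_left) (auto simp: total_influence_def)
      also have "\<dots> \<le> (\<Sum>\<^sub>\<infinity>k\<in>nodes N. q k j * survival (insert k A) t)"
        using j lower q_nonneg
        by (intro infsum_mono summable_influence_survival summable_on_cmult_left q_summable mult_left_mono) auto
      finally show ?thesis .
    qed
    then have "(\<Sum>j\<in>A. q\<^sub>0 * (y t ^ Suc (card A) - b))
        \<le> (\<Sum>j\<in>A. \<Sum>\<^sub>\<infinity>k\<in>nodes N. q k j * survival (insert k A) t)"
      by (rule sum_mono)
    then show "D' A t \<le> - (p\<^sub>0 + q\<^sub>0) * card A * D A t + q\<^sub>0 * card A * b"
      unfolding D'_def D_def loss[OF A(2)] by (simp add: algebra_simps)
  qed
  then show ?thesis by (simp add: D_def y_def)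
qed

lemma adoption_prob_eq_survival:
  assumes "m \<in> nodes N" "0 \<le> t"
  shows "adoption_prob P X m t = 1 - survival {m} t"
  using prob_neg[of "\<lambda>\<omega>. X m t \<omega>"] pred_X[OF assms] unfolding adoption_prob_def survival_def by simp

end

theorem theorem3:
  fixes p\<^sub>0 q\<^sub>0 :: real and N :: enat
    and p :: "nat \<Rightarrow> real" and q :: "nat \<Rightarrow> nat \<Rightarrow> real"
    and P :: "'w measure" and X :: "nat \<Rightarrow> real \<Rightarrow> 'w \<Rightarrow> bool"
  assumes "0 < p\<^sub>0" and "0 < q\<^sub>0"
    and "bass_process N p q P X"
    and "\<And>j. j \<in> nodes N \<Longrightarrow> p j = p\<^sub>0"
    and "\<And>j. j \<in> nodes N \<Longrightarrow> total_influence N q j = q\<^sub>0"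
  shows "(\<forall>t\<ge>0. \<forall>m\<in>nodes N. adoption_prob P X m t \<le> f_Bass t p\<^sub>0 q\<^sub>0) \<and>
         (\<forall>t\<ge>0. (N = \<infinity> \<longrightarrow> convergent (\<lambda>n. mean_adoption P X n t)) \<longrightarrow>
           adoption_level N P X t \<le> f_Bass t p\<^sub>0 q\<^sub>0)"
proof -
  interpret bass_process N p q P X by fact
  have node: "adoption_prob P X m t \<le> f_Bass t p\<^sub>0 q\<^sub>0" if "0 \<le> t" "m \<in> nodes N" for m t
    using f_Bass_complement_power_le_survival[of p\<^sub>0 q\<^sub>0 "{m}" t] assms that
    by (simp add: adoption_prob_eq_survival)
  have mean: "mean_adoption P X n t \<le> f_Bass t p\<^sub>0 q\<^sub>0" if "0 \<le> t" "0 < n" "enat n \<le> N" for n t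
  proof -
    have "j \<in> nodes N" if "j \<in> {1..n}" for j
      using that \<open>enat n \<le> N\<close> order_trans[of "enat j" "enat n" N] by (auto simp: nodes_def)
    then have "(\<Sum>j=1..n. adoption_prob P X j t) \<le> (\<Sum>j=1..n. f_Bass t p\<^sub>0 q\<^sub>0)"
      using node that by (intro sum_mono) auto
    then show ?thesis
      using \<open>0 < n\<close> by (simp add: mean_adoption_def field_simps)
  qed
  have level: "adoption_level N P X t \<le> f_Bass t p\<^sub>0 q\<^sub>0"
    if t: "0 \<le> t" and conv: "N = \<infinity> \<longrightarrow> convergent (\<lambda>n. mean_adoption P X n t)" for t
  proof (cases N)
    case (enat n)
    then show ?thesis
      using mean[OF t, of n] N_pos by (simp add: adoption_level_def zero_enat_def)
  next
    case infinity
    then have "(\<lambda>n. mean_adoption P X n t) \<longlonglongrightarrow> adoption_level N P X t"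
      using conv by (simp add: adoption_level_def convergent_LIMSEQ_iff)
    then show ?thesis
      by (rule LIMSEQ_le_const2) (use mean[OF t] infinity in \<open>auto intro!: exI[of _ 1]\<close>)
  qed
  show ?thesis using node level by blast
qed

end
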